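(* Let $M\in\mathbb{R}^{n\times n}$ be a nondegenerate matrix, $b\in\mathbb{R}^n$, $A=[M\ \ -I_n]\in\mathbb{R}^{n\times2n}$, $Q\in\{(AA^{\top})^{-1},I_n\}$, with $f_Q$, $L_Q$, $S_2$ and the operators as in the context. Then: (a) Any sequence $\{w^k\}$ generated by $w^{k+1}\in T^\lambda_{\rm PDMC}(w^k)$ with $\lambda\in(0,1/L_Q]$ has an accumulation point $w^*\in\mathrm{Fix}(T^\lambda_{\rm PDMC})$, and full sequence convergence holds if $T^\lambda_{\rm PDMC}$ is single-valued at $w^*$. (b) Any sequence $\{w^k\}$ generated by $w^{k+1}\in T^\lambda_{\rm FB}(w^k)$ with $\lambda\in(0,1/L_Q)$ has an accumulation point $w^*\in\mathrm{Fix}(T^\lambda_{\rm FB})$, and full sequence convergence holds if $T^\lambda_{\rm FB}$ is single-valued at $w^*$. (c) Any sequence $\{w^k\}$ generated by $w^{k+1}\in T^\lambda_{\rm PS}(w^k)$ with $\lambda\in(0,1/L_Q)$ has an accumulation point $w^*\in\mathrm{Fix}(T^\lambda_{\rm PS})$, and full sequence convergence holds if $T^\lambda_{\rm PS}$ is single-valued at $w^*$. Moreover, the convergence rate is locally linear.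
   Context: A square matrix is nondegenerate if all of its principal minors are nonzero. The linear complementarity problem (find $x\in\mathbb{R}^n$ with $x\ge0$, $Mx-b\ge0$, $\langle x,Mx-b\rangle=0$) is reformulated, with $w=(x,y)$, $y=Mx-b$, as finding $w\in S_1\cap S_2$, where $$S_1=\{w\in\mathbb{R}^{2n}:Aw=b\},\quad S_2=\{w\in\mathbb{R}^{2n}: w_j\ge0,\ w_{n+j}\ge0,\ w_jw_{n+j}=0\ \ \forall j\in\{1,\dots,n\}\}.$$ $\|\cdot\|$ is the Euclidean norm (operator norm for matrices). $\mathrm{Fix}(T)=\{w:w\in T(w)\}$. $P_{S_2}(w)=\arg\min_{z\in S_2}\|w-z\|$ is the (possibly set-valued) projector. $f_Q(w)=\frac12w^{\top}A^{\top}QAw-w^{\top}A^{\top}Qb+\frac12b^{\top}Qb$, with $\nabla f_Q(w)=A^{\top}Q(Aw-b)$; $L_Q=1$ if $Q=(AA^{\top})^{-1}$ and $L_Q=\|A\|^2$ if $Q=I_n$. Operators: $$T^\lambda_{\rm PDMC}(w)=\tfrac{1}{1+\lambda}\big(w-\lambda\nabla f_Q(w)+\lambda P_{S_2}(w)\big),$$ $$T^\lambda_{\rm FB}(w)=\tfrac{\lambda}{1+\lambda}P_{S_2}(w-\lambda\nabla f_Q(w))+\tfrac{1}{1+\lambda}(w-\lambda\nabla f_Q(w)),$$ $$T^\lambda_{\rm PS}(w)=P_{S_2}(w-\lambda\nabla f_Q(w)).$$ Locally linear convergence to $w^*$ means there is $\kappa\in[0,1)$ with $\|w^{k+1}-w^*\|\le\kappa\|w^k-w^*\|$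 for all sufficiently large $k$. *)

theory Defs
  imports "HOL-Analysis.Analysis"
begin

section \<open>Nondegenerate matrices\<close>

text \<open>
  The determinant of the submatrix of \<open>M\<close> with rows and columns in \<open>S\<close>, by the Leibniz formula
  that also defines \<^const>\<open>det\<close>.  The index set of a matrix in the library is a whole type,
  so the submatrix itself is not available for a set \<open>S\<close>; the lemma \<open>principal_minor_eq_det\<close>
  confirms that any enumeration of \<open>S\<close> by a finite type gives the determinant of the submatrix.
\<close>
definition principal_minor :: "real^'n^'n \<Rightarrow> 'n::finite set \<Rightarrow> real" where
  "principal_minor M S = (\<Sum>p | p permutes S. of_int (sign p) * (\<Prod>i\<in>S. M $ i $ p i))"

definition nondegenerate :: "real^'n^'n::finite \<Rightarrow> bool" where
  "nondegenerate M \<longleftrightarrow> (\<forall>S. S \<noteq> {} \<longrightarrow> principal_minor M S \<noteq> 0)"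

lemma principal_minor_eq_det:
  fixes M :: "real^'n^'n::finite" and f :: "'k::finite \<Rightarrow> 'n"
  assumes "bij_betw f UNIV S"
  shows "principal_minor M S = det (\<chi> i j. M $ f i $ f j)"
proof -
  have inj: "inj f" and img: "f ` UNIV = S"
    using assms by (auto simp: bij_betw_def)
  have fS: "f i \<in> S" for i using img by auto
  have inv: "inv f (f i) = i" for i using inj by simp
  let ?F = "map_permutation UNIV f"
  have F_eq: "?F = (\<lambda>p x. if x \<in> S then f (p (inv f x)) else x)"
    by (auto simp: fun_eq_iff map_permutation_def restrict_id_def img)
  have bij: "bij_betw ?F {p. p permutes UNIV} {p. p permutes S}"
    unfolding F_eq by (rule bij_betw_permutations[OF assms])
  have "principal_minor M S =
      (\<Sum>p | p permutes (UNIV::'k set). of_int (sign (?F p)) * (\<Prod>i\<in>S. M $ i $ ?F p i))"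
    unfolding principal_minor_def
    by (rule sum.reindex_bij_betw[OF bij, symmetric])
  also have "\<dots> = (\<Sum>p | p permutes (UNIV::'k set).
      of_int (sign p) * (\<Prod>i\<in>UNIV. M $ f i $ f (p i)))"
  proof (rule sum.cong[OF refl])
    fix p :: "'k \<Rightarrow> 'k" assume "p \<in> {p. p permutes UNIV}"
    then have p: "p permutes UNIV" by simp
    have "sign (?F p) = sign p"
      by (rule sign_map_permutation) (use p inj in auto)
    moreover have "(\<Prod>i\<in>S. M $ i $ ?F p i) = (\<Prod>i\<in>UNIV. M $ f i $ f (p i))"
      by (subst prod.reindex_bij_betw[OF assms, symmetric])
         (simp add: F_eq fS inv)
    ultimately show "of_int (sign (?F p)) * (\<Prod>i\<in>S. M $ i $ ?F p i) =
        of_int (sign p) * (\<Prod>i\<in>UNIV. M $ f i $ f (p i))" by simp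
  qed
  also have "\<dots> = det (\<chi> i j. M $ f i $ f j)"
    by (simp add: det_def)
  finally show ?thesis .
qed


section \<open>Feasibility reformulation of the linear complementarity problem\<close>

text \<open>
  The space of dimension \<open>2n\<close> is \<^typ>\<open>real^('n + 'n)\<close>: the coordinate \<open>Inl j\<close> is
  \<open>w\<^sub>j = x\<^sub>j\<close> and \<open>Inr j\<close> is \<open>w\<^sub>n\<^sub>+\<^sub>j = y\<^sub>j\<close>.
\<close>
definition lcp_matrix :: "real^'n^'n \<Rightarrow> real^('n + 'n)^'n::finite" where
  "lcp_matrix M = (\<chi> i j. case j of Inl k \<Rightarrow> M $ i $ k | Inr k \<Rightarrow> - (mat 1 :: real^'n^'n) $ i $ k)"

definition S2 :: "(real^('n::finite + 'n)) set" where
  "S2 = {w. \<forall>j. w $ Inl j \<ge> 0 \<and> w $ Inr j \<ge> 0 \<and> w $ Inl j * w $ Inr j = 0}"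

definition proj :: "'a::real_normed_vector set \<Rightarrow> 'a \<Rightarrow> 'a set" where
  "proj S w = {z. is_arg_min (\<lambda>z. norm (w - z)) (\<lambda>z. z \<in> S) z}"

definition f_Q :: "real^'m^'n \<Rightarrow> real^'n^'n \<Rightarrow> real^'n \<Rightarrow> real^'m::finite \<Rightarrow> real" where
  "f_Q A Q b w = 1/2 * (w \<bullet> (transpose A *v (Q *v (A *v w))))
     - w \<bullet> (transpose A *v (Q *v b)) + 1/2 * (b \<bullet> (Q *v b))"

definition grad_f_Q :: "real^'m^'n \<Rightarrow> real^'n^'n \<Rightarrow> real^'n \<Rightarrow> real^'m::finite \<Rightarrow> real^'m" where
  "grad_f_Q A Q b w = transpose A *v (Q *v (A *v w - b))"

lemma GDERIV_f_Q:
  assumes "transpose Q = Q"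
  shows "GDERIV (f_Q A Q b) w :> grad_f_Q A Q b w"
proof -
  have Q: "u \<bullet> (Q *v v) = v \<bullet> (Q *v u)" for u v
    by (metis assms dot_lmul_matrix inner_commute transpose_matrix_vector)
  have At: "u \<bullet> (transpose A *v v) = (A *v u) \<bullet> v" for u v
    by (metis dot_lmul_matrix inner_commute transpose_matrix_vector)
  have A': "((\<lambda>w. A *v w) has_derivative (\<lambda>h. A *v h)) (at w)"
    by (rule bounded_linear_imp_has_derivative) simp
  have Q': "((\<lambda>w. Q *v (A *v w)) has_derivative (\<lambda>h. Q *v (A *v h))) (at w)"
    by (rule bounded_linear.has_derivative[OF _ A']) simp
  have "(f_Q A Q b has_derivative
      (\<lambda>h. 1/2 * ((A *v w) \<bullet> (Q *v (A *v h)) + (A *v h) \<bullet> (Q *v (A *v w)))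
        - (A *v h) \<bullet> (Q *v b))) (at w)"
    unfolding f_Q_def At
    by (rule derivative_eq_intros A' Q' refl | simp)+
  also have "(\<lambda>h. 1/2 * ((A *v w) \<bullet> (Q *v (A *v h)) + (A *v h) \<bullet> (Q *v (A *v w)))
        - (A *v h) \<bullet> (Q *v b)) = (\<lambda>h. h \<bullet> grad_f_Q A Q b w)"
    by (simp add: fun_eq_iff grad_f_Q_def At Q[of "A *v w"] matrix_vector_mult_diff_distrib
        inner_diff_right del: transpose_matrix_vector)
  finally show ?thesis
    by (simp add: gderiv_def inner_commute)
qed


section \<open>Set-valued fixed-point operators\<close>

definition T_PDMC ::
  "real^('n + 'n)^'n \<Rightarrow> real^'n^'n \<Rightarrow> real^'n \<Rightarrow> real \<Rightarrow> real^('n::finite + 'n) \<Rightarrow> (real^('n + 'n)) set"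
  where "T_PDMC A Q b l w =
    {(1 / (1 + l)) *\<^sub>R (w - l *\<^sub>R grad_f_Q A Q b w + l *\<^sub>R z) | z. z \<in> proj S2 w}"

definition T_FB ::
  "real^('n + 'n)^'n \<Rightarrow> real^'n^'n \<Rightarrow> real^'n \<Rightarrow> real \<Rightarrow> real^('n::finite + 'n) \<Rightarrow> (real^('n + 'n)) set"
  where "T_FB A Q b l w =
    {(l / (1 + l)) *\<^sub>R z + (1 / (1 + l)) *\<^sub>R (w - l *\<^sub>R grad_f_Q A Q b w)
      | z. z \<in> proj S2 (w - l *\<^sub>R grad_f_Q A Q b w)}"

definition T_PS ::
  "real^('n + 'n)^'n \<Rightarrow> real^'n^'n \<Rightarrow> real^'n \<Rightarrow> real \<Rightarrow> real^('n::finite + 'n) \<Rightarrow> (real^('n + 'n)) set"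
  where "T_PS A Q b l w = proj S2 (w - l *\<^sub>R grad_f_Q A Q b w)"

definition Fix :: "('a \<Rightarrow> 'a set) \<Rightarrow> 'a set" where
  "Fix T = {w. w \<in> T w}"

definition generated_by :: "('a \<Rightarrow> 'a set) \<Rightarrow> (nat \<Rightarrow> 'a) \<Rightarrow> bool" where
  "generated_by T w \<longleftrightarrow> (\<forall>k. w (Suc k) \<in> T (w k))"

definition single_valued_at :: "('a \<Rightarrow> 'b set) \<Rightarrow> 'a \<Rightarrow> bool" where
  "single_valued_at T w \<longleftrightarrow> is_singleton (T w)"

definition accumulation_point :: "(nat \<Rightarrow> 'a::topological_space) \<Rightarrow> 'a \<Rightarrow> bool" where
  "accumulation_point w ws \<longleftrightarrow> (\<exists>r. strict_mono r \<and> (w \<circ> r) \<longlonglongrightarrow> ws)"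

definition locally_linear :: "(nat \<Rightarrow> 'a::real_normed_vector) \<Rightarrow> 'a \<Rightarrow> bool" where
  "locally_linear w ws \<longleftrightarrow> (\<exists>\<kappa>. 0 \<le> \<kappa> \<and> \<kappa> < 1 \<and>
     (\<forall>\<^sub>F k in sequentially. norm (w (Suc k) - ws) \<le> \<kappa> * norm (w k - ws)))"

end

theory Submission
  imports Defs
begin

text \<open>
  \<^term>\<open>S2\<close> is a finite union of convex cones, each contained in a coordinate subspace on which
  nondegeneracy makes \<open>A\<close> injective.  All three operators have the form
  \<open>(1 - t) u(w) + t P(v(w))\<close> with \<open>P\<close> the projector onto \<^term>\<open>S2\<close> and \<open>u\<close>, \<open>v\<close> affine; when \<open>P\<close> is
  replaced by the projector onto a single cone they become strict contractions, because a
  vector whose norm is preserved would lie both in the kernel of \<open>A\<close> and in the coordinate subspace.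
  Hence every generated sequence is bounded.  The objective (\<open>f\<^sub>Q\<close> plus half the squared distance to
  \<^term>\<open>S2\<close>, or \<open>f\<^sub>Q\<close> alone for projected gradients) decreases sufficiently, so consecutive
  differences vanish and accumulation points are fixed.  Near a fixed point with a unique
  projection only cones containing that projection are active, all of whose contractions share
  the fixed point; this gives local linear convergence.
\<close>

section \<open>Projections onto finite unions of convex sets\<close>

lemma proj_iff: "z \<in> proj S v \<longleftrightarrow> z \<in> S \<and> (\<forall>y\<in>S. norm (v - z) \<le> norm (v - y))"
  by (auto simp: proj_def is_arg_min_linorder)

lemma proj_nonempty:
  fixes S :: "'a::{real_normed_vector, heine_borel} set"
  assumes "closed S" "S \<noteq> {}"
  shows "proj S v \<noteq> {}"
  using distance_attains_inf[OF assms, of v]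
  by (metis dist_norm empty_iff proj_iff)

lemma infdist_proj:
  assumes "z \<in> proj S v"
  shows "infdist v S = norm (v - z)"
proof -
  have "z \<in> S" "\<And>y. y \<in> S \<Longrightarrow> dist v z \<le> dist v y"
    using assms by (auto simp: proj_iff dist_norm)
  moreover from this have "dist v z \<le> infdist v S"
    unfolding infdist_def by (auto intro!: cINF_greatest)
  ultimately have "infdist v S \<le> dist v z" "dist v z \<le> infdist v S"
    by (auto simp: infdist_le)
  then show ?thesis by (simp add: dist_norm)
qed

text \<open>Minimality passes to the limit whichever nearest points are selected along the way; this
  replaces continuity of the set-valued projector.\<close>

lemma proj_closed_graph:
  assumes "closed S" "\<And>k. z k \<in> proj S (v k)" "v \<longlonglongrightarrow> v'" "z \<longlonglongrightarrow> z'"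
  shows "z' \<in> proj S v'"
  unfolding proj_iff
proof (intro conjI ballI)
  show "z' \<in> S"
    using assms by (metis closed_sequential_limits proj_iff)
  fix y assume "y \<in> S"
  then show "norm (v' - z') \<le> norm (v' - y)"
    using assms by (intro LIMSEQ_le[of "\<lambda>k. norm (v k - z k)" _ "\<lambda>k. norm (v k - y)"])
      (auto intro!: tendsto_intros simp: proj_iff)
qed

text \<open>\<open>T_PDMC\<close> and \<open>T_FB\<close> arise with \<open>t = l / (1 + l)\<close>
  and \<open>u\<close> the gradient step, \<open>v\<close> being the identity or that step again;
  \<open>T_PS\<close> is the case \<open>t = 1\<close>.\<close>

definition relaxed_proj ::
  "'a::real_normed_vector set \<Rightarrow> real \<Rightarrow> ('a \<Rightarrow> 'a) \<Rightarrow> ('a \<Rightarrow> 'a) \<Rightarrow> 'a \<Rightarrow> 'a set" where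
  "relaxed_proj S t u v w = {(1 - t) *\<^sub>R u w + t *\<^sub>R z | z. z \<in> proj S (v w)}"

text \<open>
  \<^term>\<open>P i\<close> plays the role of the orthogonal projector onto a subspace parallel to \<^term>\<open>R i\<close>.
\<close>
locale piecewise_projection =
  fixes I :: "'i set" and R :: "'i \<Rightarrow> 'a::euclidean_space set" and P :: "'i \<Rightarrow> 'a \<Rightarrow> 'a"
  assumes finite_I: "finite I" and I_nonempty: "I \<noteq> {}"
    and closed_R: "i \<in> I \<Longrightarrow> closed (R i)"
    and convex_R: "i \<in> I \<Longrightarrow> convex (R i)"
    and R_nonempty: "i \<in> I \<Longrightarrow> R i \<noteq> {}"
    and linear_P: "i \<in> I \<Longrightarrow> linear (P i)"
    and norm_P_le: "i \<in> I \<Longrightarrow> norm (P i x) \<le> norm x"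
    and inner_P: "i \<in> I \<Longrightarrow> y \<in> R i \<Longrightarrow> z \<in> R i \<Longrightarrow> x \<bullet> (y - z) = P i x \<bullet> (y - z)"
begin

abbreviation S :: "'a set" where "S \<equiv> \<Union>i\<in>I. R i"

lemma closed_S: "closed S"
  using finite_I closed_R by (intro closed_UN) auto

lemma S_nonempty: "S \<noteq> {}"
  using I_nonempty R_nonempty by auto

text \<open>The two obtuse-angle inequalities add up to firm nonexpansiveness. As
  \<open>z - z'\<close> is a difference of points of \<open>R i\<close>, \<open>inner_P\<close> puts
  \<open>P i (x - x')\<close> in place of \<open>x - x'\<close> before Cauchy-Schwarz.\<close>

lemma piece_projection_nonexpansive:
  assumes i: "i \<in> I" and z: "z \<in> proj (R i) x" and z': "z' \<in> proj (R i) x'"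
  shows "norm (z - z') \<le> norm (P i (x - x'))"
proof -
  have in_R: "z \<in> R i" "z' \<in> R i"
    using z z' by (auto simp: proj_iff)
  have "(x - z) \<bullet> (z' - z) \<le> 0" "(x' - z') \<bullet> (z - z') \<le> 0"
    using z z' in_R
    by (auto intro!: any_closest_point_dot[OF convex_R[OF i] closed_R[OF i]]
        simp: proj_iff dist_norm)
  then have "(z - z') \<bullet> (z - z') \<le> (x - x') \<bullet> (z - z')"
    by (simp add: inner_diff_left inner_diff_right algebra_simps)
  also have "\<dots> = P i (x - x') \<bullet> (z - z')"
    using inner_P[OF i in_R] .
  also have "\<dots> \<le> norm (P i (x - x')) * norm (z - z')"
    by (rule norm_cauchy_schwarz)
  finally have "norm (z - z') * norm (z - z') \<le> norm (P i (x - x')) * norm (z - z')"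
    by (simp add: dot_square_norm power2_eq_square)
  then show ?thesis
    by (cases "z = z'") auto
qed

lemma proj_piece: "z \<in> proj S x \<Longrightarrow> i \<in> I \<Longrightarrow> z \<in> R i \<Longrightarrow> z \<in> proj (R i) x"
  by (auto simp: proj_iff)

lemma proj_in_piece:
  assumes "z \<in> proj S x"
  obtains i where "i \<in> I" "z \<in> R i" "z \<in> proj (R i) x"
  using assms by (auto simp: proj_iff)

text \<open>Near a point with a unique projection only the pieces containing that projection matter.\<close>
lemma eventually_active_piece:
  assumes single: "proj S x = {z}"
  shows "\<forall>\<^sub>F y in nhds x. \<forall>i\<in>I. \<forall>z'\<in>proj S y. z' \<in> R i \<longrightarrow> z \<in> R i"
proof -
  have "\<forall>\<^sub>F y in nhds x. \<forall>z'\<in>proj S y. z' \<in> R i \<longrightarrow> z \<in> R i" if i: "i \<in> I" for i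
  proof (cases "z \<in> R i")
    case False
    obtain p where p: "p \<in> proj (R i) x"
      using proj_nonempty[OF closed_R[OF i] R_nonempty[OF i]] by blast
    then have pS: "p \<in> S" "p \<noteq> z" using i False by (auto simp: proj_iff)
    have z: "z \<in> proj S x" and np: "p \<notin> proj S x" using single pS by auto
    have min: "norm (x - z) \<le> norm (x - y)" if "y \<in> S" for y
      using z that unfolding proj_iff by blast
    have "norm (x - z) < norm (x - p)"
    proof (rule ccontr)
      assume "\<not> ?thesis"
      then have "\<forall>y\<in>S. norm (x - p) \<le> norm (x - y)" using min by force
      then show False using np pS unfolding proj_iff by blast
    qed
    \<comment> \<open>This gap is continuous in the base point, so it stays positive nearby, whereas
      a projection onto \<open>S\<close> lying in \<open>R i\<close> would make it zero.\<close>
    then have "infdist x S < infdist x (R i)"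
      using infdist_proj[OF z] infdist_proj[OF p] by simp
    then have "\<forall>\<^sub>F y in nhds x. 0 < infdist y (R i) - infdist y S"
      by (intro order_tendstoD[where y = "infdist x (R i) - infdist x S"] tendsto_intros filterlim_ident) auto
    then show ?thesis
    proof eventually_elim
      case (elim y)
      show ?case
      proof (intro ballI impI)
        fix z' assume z': "z' \<in> proj S y" "z' \<in> R i"
        then have "infdist y S = infdist y (R i)"
          using infdist_proj[OF proj_piece[OF z'(1) i z'(2)]] infdist_proj[OF z'(1)] by simp
        with elim show "z \<in> R i" by simp
      qed
    qed
  qed auto
  then show ?thesis
    using finite_I by (simp add: eventually_ball_finite)
qed

end

section \<open>Contraction, boundedness and local convergence of relaxed projections\<close>

locale relaxed_projection = piecewise_projection I R P
  for I :: "'i set" and R :: "'i \<Rightarrow> 'a::euclidean_space set" and P :: "'i \<Rightarrow> 'a \<Rightarrow> 'a" +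
  fixes t :: real and u v G K :: "'a \<Rightarrow> 'a"
  assumes t_pos: "0 < t" and t_le: "t \<le> 1"
    and linear_G: "linear G" and linear_K: "linear K"
    and u_diff: "u x - u y = G (x - y)" and v_diff: "v x - v y = K (x - y)"
    and strict: "i \<in> I \<Longrightarrow> d \<noteq> 0 \<Longrightarrow> (1 - t) * norm (G d) + t * norm (P i (K d)) < norm d"
begin

abbreviation T :: "'a \<Rightarrow> 'a set" where "T \<equiv> relaxed_proj S t u v"

text \<open>By compactness the strict inequality on the unit sphere gives a maximum below 1 for each
  piece. Homogeneity extends the bound to every \<open>d\<close>, and the finitely many pieces share
  the largest factor.\<close>

lemma uniform_contraction:
  obtains \<kappa> where "0 \<le> \<kappa>" "\<kappa> < 1"
    "\<And>i d. i \<in> I \<Longrightarrow> (1 - t) * norm (G d) + t * norm (P i (K d)) \<le> \<kappa> * norm d"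
proof -
  let ?g = "\<lambda>i d. (1 - t) * norm (G d) + t * norm (P i (K d))"
  have ex: "\<exists>\<kappa>. 0 \<le> \<kappa> \<and> \<kappa> < 1 \<and> (\<forall>d. ?g i d \<le> \<kappa> * norm d)" if i: "i \<in> I" for i
  proof -
    interpret P: linear "P i" using linear_P[OF i] .
    interpret K: linear K by (rule linear_K)
    interpret G: linear G by (rule linear_G)
    have cont: "continuous_on (sphere 0 1) (?g i)"
      by (intro continuous_on_add continuous_on_mult_left continuous_on_norm
          linear_continuous_on_compose[OF _ linear_P[OF i]] linear_continuous_on
          linear_K[unfolded linear_conv_bounded_linear] linear_G[unfolded linear_conv_bounded_linear])
    have "sphere (0::'a) 1 \<noteq> {}" by simp
    then obtain e where e: "e \<in> sphere 0 1" "\<And>d. d \<in> sphere 0 1 \<Longrightarrow> ?g i d \<le> ?g i e"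
      using continuous_attains_sup[OF compact_sphere _ cont] by blast
    have "?g i d \<le> ?g i e * norm d" for d
    proof (cases "d = 0")
      case True
      then show ?thesis by (simp add: G.zero K.zero P.zero)
    next
      case False
      have "?g i ((1 / norm d) *\<^sub>R d) \<le> ?g i e"
        using False by (intro e) auto
      also have "?g i ((1 / norm d) *\<^sub>R d) = ?g i d / norm d"
        by (simp add: G.scale K.scale P.scale add_divide_distrib)
      finally show ?thesis using False by (simp add: pos_divide_le_eq)
    qed
    moreover have "0 \<le> ?g i e" using t_pos t_le by simp
    moreover have "?g i e < 1" using strict[OF i, of e] e(1) by force
    ultimately show ?thesis by blast
  qed
  then obtain k where k: "\<And>i. i \<in> I \<Longrightarrow> 0 \<le> k i \<and> k i < 1 \<and> (\<forall>d. ?g i d \<le> k i * norm d)"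
    by metis
  let ?m = "Max (k ` I)"
  have ge: "k i \<le> ?m" if "i \<in> I" for i using that finite_I by simp
  have "?m \<in> k ` I" using finite_I I_nonempty by (intro Max_in) auto
  then have "0 \<le> ?m" "?m < 1" using k by auto
  moreover have "?g i d \<le> ?m * norm d" if "i \<in> I" for i d
    using k[OF that] ge[OF that] mult_right_mono[of "k i" ?m "norm d"] by (meson norm_ge_zero order_trans)
  ultimately show ?thesis using that by blast
qed

text \<open>Both points are projected onto the same convex piece, where projection cannot jump;
  \<open>G\<close> and \<open>K\<close>, the linear parts of \<open>u\<close> and \<open>v\<close>,
  then carry the difference.\<close>

lemma piece_step_le:
  assumes "i \<in> I" "z \<in> proj (R i) (v x)" "z' \<in> proj (R i) (v y)"
  shows "norm (((1 - t) *\<^sub>R u x + t *\<^sub>R z) - ((1 - t) *\<^sub>R u y + t *\<^sub>R z'))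
    \<le> (1 - t) * norm (G (x - y)) + t * norm (P i (K (x - y)))"
proof -
  have "((1 - t) *\<^sub>R u x + t *\<^sub>R z) - ((1 - t) *\<^sub>R u y + t *\<^sub>R z')
      = (1 - t) *\<^sub>R G (x - y) + t *\<^sub>R (z - z')"
    by (simp add: u_diff[symmetric] algebra_simps)
  moreover have "norm (z - z') \<le> norm (P i (K (x - y)))"
    using piece_projection_nonexpansive[OF assms] by (simp add: v_diff)
  ultimately show ?thesis
    using t_pos t_le by (auto intro!: order_trans[OF norm_triangle_ineq] mult_left_mono)
qed

text \<open>Each step is compared with the step from the origin through the same piece. There are
  finitely many such reference points, so the norms obey an affine recursion with factor
  \<open>\<kappa>\<close> and offset \<open>B\<close>.\<close>

lemma generated_bounded:
  assumes "generated_by T w"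
  shows "bounded (range w)"
proof -
  obtain \<kappa> where \<kappa>: "0 \<le> \<kappa>" "\<kappa> < 1"
    "\<And>i d. i \<in> I \<Longrightarrow> (1 - t) * norm (G d) + t * norm (P i (K d)) \<le> \<kappa> * norm d"
    using uniform_contraction by blast
  have "\<exists>p. p \<in> proj (R i) (v 0)" if "i \<in> I" for i
    using proj_nonempty[OF closed_R[OF that] R_nonempty[OF that]] by blast
  then obtain p where p: "\<And>i. i \<in> I \<Longrightarrow> p i \<in> proj (R i) (v 0)" by metis
  define B where "B = Max ((\<lambda>i. norm ((1 - t) *\<^sub>R u 0 + t *\<^sub>R p i)) ` I)"
  have B: "norm ((1 - t) *\<^sub>R u 0 + t *\<^sub>R p i) \<le> B" if "i \<in> I" for i
    using that finite_I by (simp add: B_def)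
  have B0: "0 \<le> B" using B I_nonempty by (meson all_not_in_conv norm_ge_zero order_trans)
  have step: "norm (w (Suc k)) \<le> \<kappa> * norm (w k) + B" for k
  proof -
    obtain z where z: "z \<in> proj S (v (w k))" "w (Suc k) = (1 - t) *\<^sub>R u (w k) + t *\<^sub>R z"
      using assms by (auto simp: generated_by_def relaxed_proj_def)
    obtain i where i: "i \<in> I" "z \<in> proj (R i) (v (w k))"
      using proj_in_piece[OF z(1)] by blast
    have "norm (w (Suc k) - ((1 - t) *\<^sub>R u 0 + t *\<^sub>R p i)) \<le> \<kappa> * norm (w k)"
      using piece_step_le[OF i p[OF i(1)]] \<kappa>(3)[OF i(1), of "w k"] z(2) by simp
    then show ?thesis using B[OF i(1)] norm_triangle_sub[of "w (Suc k)"]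
      by (smt (verit, best))
  qed
  \<comment> \<open>\<open>B / (1 - \<kappa>)\<close> is the fixed point of that recursion; adding
    \<open>norm (w 0)\<close> covers the start and still gives a level that one step cannot
    exceed.\<close>
  define C where "C = norm (w 0) + B / (1 - \<kappa>)"
  have C: "\<kappa> * C + B \<le> C"
  proof -
    have "C - \<kappa> * C = (1 - \<kappa>) * C" by (simp add: algebra_simps)
    also have "\<dots> = (1 - \<kappa>) * norm (w 0) + B"
      using \<kappa>(2) by (simp add: C_def distrib_left)
    finally have "C - \<kappa> * C = (1 - \<kappa>) * norm (w 0) + B" .
    moreover have "0 \<le> (1 - \<kappa>) * norm (w 0)" using \<kappa>(2) by simp
    ultimately show ?thesis by linarith
  qed
  have "norm (w k) \<le> C" for k
  proof (induction k)
    case 0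
    then show ?case using B0 \<kappa> by (simp add: C_def)
  next
    case (Suc k)
    have "norm (w (Suc k)) \<le> \<kappa> * C + B"
      using step[of k] mult_left_mono[OF Suc \<kappa>(1)] by linarith
    then show ?case using C by linarith
  qed
  then show ?thesis by (auto simp: bounded_iff)
qed

lemma continuous_u: "isCont u x" and continuous_v: "isCont v x"
proof -
  have "u 0 + G y = u y" "v 0 + K y = v y" for y
    using u_diff[of y 0] v_diff[of y 0] by (auto simp: algebra_simps)
  moreover have "isCont (\<lambda>y. u 0 + G y) x" "isCont (\<lambda>y. v 0 + K y) x"
    by (intro continuous_add continuous_const linear_continuous_at
        linear_K[unfolded linear_conv_bounded_linear] linear_G[unfolded linear_conv_bounded_linear])+
  ultimately show "isCont u x" "isCont v x" by simp_all
qed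

text \<open>Along a convergent subsequence the successors have the same limit, because the
  increments vanish; the closed graph of the projector then yields the fixed-point relation.\<close>

lemma accumulation_point_in_Fix:
  assumes gen: "generated_by T w" and reg: "(\<lambda>k. w (Suc k) - w k) \<longlonglongrightarrow> 0"
  shows "\<exists>ws. accumulation_point w ws \<and> ws \<in> Fix T"
proof -
  obtain ws r where r: "strict_mono (r :: nat \<Rightarrow> nat)" "(w \<circ> r) \<longlonglongrightarrow> ws"
    using bounded_imp_convergent_subsequence[OF generated_bounded[OF gen]] by blast
  have "\<forall>k. \<exists>z. z \<in> proj S (v (w k)) \<and> w (Suc k) = (1 - t) *\<^sub>R u (w k) + t *\<^sub>R z"
    using gen by (auto simp: generated_by_def relaxed_proj_def)
  then obtain z where z: "\<And>k. z k \<in> proj S (v (w k))"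
    "\<And>k. w (Suc k) = (1 - t) *\<^sub>R u (w k) + t *\<^sub>R z k" by metis
  \<comment> \<open>As \<open>t\<close> is positive, the selected projection can be recovered from
    two consecutive iterates, so it converges along the subsequence too.\<close>
  have z_eq: "z k = (1 / t) *\<^sub>R (w k + (w (Suc k) - w k) - (1 - t) *\<^sub>R u (w k))" for k
    using z(2)[of k] t_pos by simp
  \<comment> \<open>The summand 0 is the limit of the increments, kept so that the terms match those
    of \<open>z_eq\<close> one by one.\<close>
  define zs where "zs = (1 / t) *\<^sub>R (ws + 0 - (1 - t) *\<^sub>R u ws)"
  have wr: "(\<lambda>k. w (r k)) \<longlonglongrightarrow> ws" using r(2) by (simp add: o_def)
  have "(\<lambda>k. w (Suc (r k)) - w (r k)) \<longlonglongrightarrow> 0"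
    using LIMSEQ_subseq_LIMSEQ[OF reg r(1)] by (simp add: o_def)
  then have "(\<lambda>k. z (r k)) \<longlonglongrightarrow> zs"
    unfolding z_eq zs_def
    by (intro tendsto_intros wr isCont_tendsto_compose[OF continuous_u wr])
  moreover have "(\<lambda>k. v (w (r k))) \<longlonglongrightarrow> v ws"
    by (rule isCont_tendsto_compose[OF continuous_v wr])
  ultimately have "zs \<in> proj S (v ws)"
    using proj_closed_graph[OF closed_S, of "\<lambda>k. z (r k)" "\<lambda>k. v (w (r k))"] z(1) by blast
  moreover have "ws = (1 - t) *\<^sub>R u ws + t *\<^sub>R zs"
    using t_pos by (simp add: zs_def)
  ultimately have "ws \<in> Fix T" by (auto simp: Fix_def relaxed_proj_def)
  then show ?thesis using r by (auto simp: accumulation_point_def)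
qed

text \<open>Near \<open>ws\<close> only pieces containing the unique projection \<open>zs\<close>
  are active, and their single-piece steps all fix \<open>ws\<close>. One iterate close to
  \<open>ws\<close> is therefore drawn in geometrically, together with all later ones.\<close>

lemma local_linear_convergence:
  assumes gen: "generated_by T w" and acc: "accumulation_point w ws"
    and fix_ws: "ws \<in> Fix T" and single: "single_valued_at T ws"
  shows "w \<longlonglongrightarrow> ws \<and> locally_linear w ws"
proof -
  obtain \<kappa> where \<kappa>: "0 \<le> \<kappa>" "\<kappa> < 1"
    "\<And>i d. i \<in> I \<Longrightarrow> (1 - t) * norm (G d) + t * norm (P i (K d)) \<le> \<kappa> * norm d"
    using uniform_contraction by blast
  obtain zs where zs: "zs \<in> proj S (v ws)" "ws = (1 - t) *\<^sub>R u ws + t *\<^sub>R zs"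
    using fix_ws by (auto simp: Fix_def relaxed_proj_def)
  obtain ws' where ws': "T ws = {ws'}"
    using single by (auto simp: single_valued_at_def is_singleton_def)
  \<comment> \<open>Since \<open>t\<close> is positive, distinct projections would give distinct
    values of \<open>T\<close>, so single-valuedness passes from \<open>T\<close> to the
    projector.\<close>
  have "z = zs" if "z \<in> proj S (v ws)" for z
  proof -
    have "(1 - t) *\<^sub>R u ws + t *\<^sub>R z \<in> T ws" "(1 - t) *\<^sub>R u ws + t *\<^sub>R zs \<in> T ws"
      using that zs(1) by (auto simp: relaxed_proj_def)
    then have "(1 - t) *\<^sub>R u ws + t *\<^sub>R z = (1 - t) *\<^sub>R u ws + t *\<^sub>R zs"
      unfolding ws' by simp
    then show ?thesis using t_pos by simp
  qed
  with zs(1) have "proj S (v ws) = {zs}" by blast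
  then have "\<forall>\<^sub>F y in nhds (v ws). \<forall>i\<in>I. \<forall>z\<in>proj S y. z \<in> R i \<longrightarrow> zs \<in> R i"
    by (rule eventually_active_piece)
  moreover have "filterlim v (nhds (v ws)) (nhds ws)"
    using continuous_v[of ws] by (simp add: isCont_def tendsto_at_iff_tendsto_nhds)
  ultimately have "\<forall>\<^sub>F x in nhds ws. \<forall>i\<in>I. \<forall>z\<in>proj S (v x). z \<in> R i \<longrightarrow> zs \<in> R i"
    by (rule eventually_compose_filterlim)
  then obtain \<delta> where \<delta>: "0 < \<delta>"
    "\<And>x i z. dist x ws < \<delta> \<Longrightarrow> i \<in> I \<Longrightarrow> z \<in> proj S (v x) \<Longrightarrow> z \<in> R i \<Longrightarrow> zs \<in> R i"
    unfolding eventually_nhds_metric by blast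
  have step: "norm (w (Suc k) - ws) \<le> \<kappa> * norm (w k - ws)" if k: "norm (w k - ws) < \<delta>" for k
  proof -
    obtain z where z: "z \<in> proj S (v (w k))" "w (Suc k) = (1 - t) *\<^sub>R u (w k) + t *\<^sub>R z"
      using gen by (auto simp: generated_by_def relaxed_proj_def)
    obtain i where i: "i \<in> I" "z \<in> R i" "z \<in> proj (R i) (v (w k))"
      using proj_in_piece[OF z(1)] by blast
    \<comment> \<open>Hence \<open>zs\<close> is also the projection of \<open>v ws\<close> onto the
      piece active at \<open>w k\<close>, and \<open>piece_step_le\<close> compares
      \<open>w (Suc k)\<close> with \<open>ws\<close> itself.\<close>
    have "zs \<in> R i" using \<delta>(2)[OF _ i(1) z(1) i(2)] k by (simp add: dist_norm)
    then have "zs \<in> proj (R i) (v ws)" using proj_piece[OF zs(1) i(1)] by blast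
    from piece_step_le[OF i(1) i(3) this] show ?thesis
      using \<kappa>(3)[OF i(1), of "w k - ws"] z(2) zs(2) by simp
  qed
  obtain r where r: "(w \<circ> r) \<longlonglongrightarrow> ws"
    using acc by (auto simp: accumulation_point_def)
  obtain k0 where k0: "norm (w k0 - ws) < \<delta>"
    using LIMSEQ_D[OF r \<delta>(1)] by auto
  \<comment> \<open>Membership in the ball is part of the induction because \<open>step\<close> is
    available only there.\<close>
  have power: "norm (w (k + k0) - ws) \<le> \<kappa> ^ k * norm (w k0 - ws) \<and> norm (w (k + k0) - ws) < \<delta>" for k
  proof (induction k)
    case (Suc k)
    then have *: "norm (w (Suc k + k0) - ws) \<le> \<kappa> * norm (w (k + k0) - ws)"
      using step by simp
    also have "\<dots> \<le> \<kappa> * (\<kappa> ^ k * norm (w k0 - ws))"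
      using Suc \<kappa>(1) by (intro mult_left_mono) auto
    finally show ?case
      using * Suc \<kappa> mult_left_le_one_le[of "norm (w (k + k0) - ws)" \<kappa>]
      by (simp add: mult.assoc)
  qed (simp add: k0)
  have "(\<lambda>k. \<kappa> ^ k * norm (w k0 - ws)) \<longlonglongrightarrow> 0 * norm (w k0 - ws)"
    using \<kappa> by (intro tendsto_intros LIMSEQ_realpow_zero)
  then have lim: "(\<lambda>k. \<kappa> ^ k * norm (w k0 - ws)) \<longlonglongrightarrow> 0" by simp
  have "(\<lambda>k. norm (w (k + k0) - ws)) \<longlonglongrightarrow> 0"
    by (rule tendsto_sandwich[OF _ _ tendsto_const lim])
      (simp_all add: power always_eventually)
  then have "(\<lambda>k. w (k + k0)) \<longlonglongrightarrow> ws"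
    by (rule LIM_zero_cancel[OF tendsto_norm_zero_cancel])
  then have "w \<longlonglongrightarrow> ws" by (rule LIMSEQ_offset)
  moreover have "norm (w (Suc k) - ws) \<le> \<kappa> * norm (w k - ws)" if "k \<ge> k0" for k
    using power[of "k - k0"] step[of k] that by simp
  then have "locally_linear w ws"
    using \<kappa>(1,2) unfolding locally_linear_def eventually_sequentially by blast
  ultimately show ?thesis by blast
qed

end


section \<open>Quadratic objectives\<close>

text \<open>The values \<open>e k\<close> decrease to a limit, so their consecutive differences
  vanish and squeeze the squared increments.\<close>

lemma vanishing_steps:
  fixes w :: "nat \<Rightarrow> 'a::real_normed_vector"
  assumes "0 < a" and dec: "\<And>k. e (Suc k) \<le> e k - a * (norm (w (Suc k) - w k))\<^sup>2"
    and lower: "\<And>k. m \<le> (e k :: real)"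
  shows "(\<lambda>k. w (Suc k) - w k) \<longlonglongrightarrow> 0"
proof -
  have "decseq e"
    using dec \<open>0 < a\<close> by (intro decseq_SucI) (smt (verit) mult_nonneg_nonneg zero_le_power2)
  then obtain m' where m': "e \<longlonglongrightarrow> m'"
    using decseq_convergent[of e m] lower by blast
  have "(\<lambda>k. (e k - e (Suc k)) / a) \<longlonglongrightarrow> (m' - m') / a"
    using \<open>0 < a\<close> by (intro tendsto_intros m' LIMSEQ_Suc) auto
  then have lim: "(\<lambda>k. (e k - e (Suc k)) / a) \<longlonglongrightarrow> 0" by simp
  have "(norm (w (Suc k) - w k))\<^sup>2 \<le> (e k - e (Suc k)) / a" for k
    using dec[of k] \<open>0 < a\<close> by (simp add: field_simps)
  then have "(\<lambda>k. (norm (w (Suc k) - w k))\<^sup>2) \<longlonglongrightarrow> 0"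
    by (intro tendsto_sandwich[OF _ _ tendsto_const lim]) (auto intro!: always_eventually)
  from tendsto_real_sqrt[OF this] have "(\<lambda>k. norm (w (Suc k) - w k)) \<longlonglongrightarrow> 0"
    by simp
  then show ?thesis by (rule tendsto_norm_zero_cancel)
qed

text \<open>\<open>norm_H\<close> states cocoercivity of \<open>H\<close>. With \<open>L_pos\<close>
  it yields positive semidefiniteness, the curvature bound \<open>H_le\<close>, and
  \<open>H x = 0\<close> whenever the quadratic form vanishes at \<open>x\<close>.\<close>

locale convex_quadratic =
  fixes H :: "'a::euclidean_space \<Rightarrow> 'a" and c :: 'a and L :: real
  assumes linear_H: "linear H" and symmetric_H: "x \<bullet> H y = H x \<bullet> y"
    and norm_H: "(norm (H x))\<^sup>2 \<le> L * (x \<bullet> H x)" and L_pos: "0 < L"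
begin

sublocale H: linear H by (rule linear_H)

text \<open>For the \<open>H\<close> and \<open>c\<close> of the complementarity problem this is
  \<open>f_Q\<close> up to an additive constant, which does not affect descent.\<close>

definition quad :: "'a \<Rightarrow> real" where "quad w = 1/2 * (w \<bullet> H w) - c \<bullet> w"

lemma H_nonneg: "0 \<le> x \<bullet> H x"
  using norm_H[of x] L_pos by (meson order_trans zero_le_mult_iff zero_le_power2 not_less)

lemma H_le: "x \<bullet> H x \<le> L * (norm x)\<^sup>2"
proof (cases "x \<bullet> H x = 0")
  case True
  then show ?thesis using L_pos by simp
next
  case False
  then have pos: "0 < x \<bullet> H x" using H_nonneg[of x] by linarith
  have "(x \<bullet> H x) * (x \<bullet> H x) \<le> (norm x)\<^sup>2 * (norm (H x))\<^sup>2"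
    using Cauchy_Schwarz_ineq[of x "H x"] by (simp add: power2_eq_square dot_square_norm)
  also have "\<dots> \<le> (norm x)\<^sup>2 * (L * (x \<bullet> H x))"
    using norm_H by (intro mult_left_mono) auto
  finally show ?thesis using pos by (simp add: mult.commute)
qed

lemma H_eq_0: "x \<bullet> H x = 0 \<Longrightarrow> H x = 0"
  using norm_H[of x] by simp

text \<open>Descent lemma: the second-order expansion is exact, and \<open>H_le\<close> bounds its
  last term.\<close>

lemma quad_step:
  "quad (w + h) \<le> quad w + (H w - c) \<bullet> h + L / 2 * (norm h)\<^sup>2"
proof -
  have "quad (w + h) = quad w + (H w - c) \<bullet> h + 1/2 * (h \<bullet> H h)"
    using symmetric_H[of w h] by (simp add: quad_def H.add algebra_simps inner_commute)
  then show ?thesis using H_le[of h] by simp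
qed

lemma quad_lower: "norm w \<le> B \<Longrightarrow> - (norm c * B) \<le> quad w"
proof -
  assume "norm w \<le> B"
  then have "c \<bullet> w \<le> norm c * B"
    using norm_cauchy_schwarz[of c w] mult_left_mono[of "norm w" B "norm c"] by simp
  then show ?thesis using H_nonneg[of w] by (simp add: quad_def)
qed

text \<open>Expanding the square gives \<open>- 2 * l * (x \<bullet> H x)\<close> and a term in
  \<open>norm (H x)\<close>; by cocoercivity and \<open>l * L \<le> 1\<close> the latter consumes at
  most half of the former.\<close>

lemma gradient_step_norm:
  assumes l: "0 < l" "l * L \<le> 1"
  shows "(norm (x - l *\<^sub>R H x))\<^sup>2 \<le> (norm x)\<^sup>2 - l * (x \<bullet> H x)"
proof -
  have "(norm (x - l *\<^sub>R H x))\<^sup>2 = (norm x)\<^sup>2 - 2 * l * (x \<bullet> H x) + l * (l * (norm (H x))\<^sup>2)"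
    unfolding dot_square_norm[symmetric]
    by (simp add: inner_diff_left inner_diff_right inner_commute algebra_simps)
  moreover have "l * (norm (H x))\<^sup>2 \<le> x \<bullet> H x"
  proof -
    have "l * (norm (H x))\<^sup>2 \<le> (l * L) * (x \<bullet> H x)"
      using mult_left_mono[OF norm_H[of x], of l] l by (simp add: mult.assoc)
    also have "\<dots> \<le> 1 * (x \<bullet> H x)" by (intro mult_right_mono l H_nonneg)
    finally show ?thesis by simp
  qed
  then have "l * (l * (norm (H x))\<^sup>2) \<le> l * (x \<bullet> H x)" using l by simp
  ultimately show ?thesis by simp
qed

lemma gradient_step_nonexpansive:
  assumes "0 < l" "l * L \<le> 1"
  shows "norm (x - l *\<^sub>R H x) \<le> norm x"
proof -
  have "(norm (x - l *\<^sub>R H x))\<^sup>2 \<le> (norm x)\<^sup>2"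
    using gradient_step_norm[OF assms, of x] H_nonneg[of x] assms(1) by (smt (verit) mult_nonneg_nonneg)
  then show ?thesis by (simp add: abs_le_square_iff[symmetric])
qed

lemma gradient_step_strict:
  assumes "0 < l" "l * L \<le> 1" "H x \<noteq> 0"
  shows "norm (x - l *\<^sub>R H x) < norm x"
proof -
  have "0 < x \<bullet> H x" using H_nonneg[of x] H_eq_0[of x] assms(3) by fastforce
  then have "(norm (x - l *\<^sub>R H x))\<^sup>2 < (norm x)\<^sup>2"
    using gradient_step_norm[OF assms(1,2), of x] assms(1) by (smt (verit) mult_pos_pos)
  then show ?thesis by (simp add: power_less_imp_less_base)
qed

end

section \<open>Contraction and energy descent for the three iterations\<close>

locale quadratic_feasibility =
  piecewise_projection I R P + convex_quadratic H c L
  for I :: "'i set" and R :: "'i \<Rightarrow> 'a::euclidean_space set" and P :: "'i \<Rightarrow> 'a \<Rightarrow> 'a"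
    and H :: "'a \<Rightarrow> 'a" and c :: 'a and L :: real +
  assumes transversal: "i \<in> I \<Longrightarrow> H x = 0 \<Longrightarrow> norm (P i x) = norm x \<Longrightarrow> x = 0"
begin

abbreviation gradient_step :: "real \<Rightarrow> 'a \<Rightarrow> 'a" where
  "gradient_step l w \<equiv> w - l *\<^sub>R (H w - c)"

definition energy :: "'a \<Rightarrow> real" where
  "energy w = quad w + 1/2 * (infdist w S)\<^sup>2"

text \<open>Any point of \<open>S\<close> majorizes the energy, with equality for a projection. The
  descent proofs use the bound at the new iterate and equality at the old one.\<close>

lemma energy_le: "z \<in> S \<Longrightarrow> energy w \<le> quad w + 1/2 * (norm (w - z))\<^sup>2"
  using infdist_le[of z S w] by (simp add: energy_def dist_norm power_mono infdist_nonneg)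

lemma energy_eq: "z \<in> proj S w \<Longrightarrow> energy w = quad w + 1/2 * (norm (w - z))\<^sup>2"
  by (simp add: energy_def infdist_proj)

lemma energy_lower: "norm w \<le> B \<Longrightarrow> - (norm c * B) \<le> energy w"
  using quad_lower[of w B] by (simp add: energy_def add_increasing2)

lemma linear_gradient_step: "linear (\<lambda>d. d - l *\<^sub>R H d)"
  by (intro linear_compose_sub linear_compose_scale_right linear_ident linear_H)

lemma gradient_step_diff: "gradient_step l x - gradient_step l y = (x - y) - l *\<^sub>R H (x - y)"
  by (simp add: H.diff algebra_simps)

text \<open>If \<open>H d = 0\<close>, transversality makes \<open>P i d\<close> strictly shorter
  than \<open>d\<close>; otherwise the gradient step is strictly shorter, and its weight
  \<open>1 - t\<close> is positive since \<open>t < 1\<close>.\<close>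

lemma relaxed_projection_identity:
  assumes l: "0 < l" "l * L \<le> 1" and t: "0 < t" "t < 1"
  shows "relaxed_projection I R P t (gradient_step l) (\<lambda>w. w) (\<lambda>d. d - l *\<^sub>R H d) (\<lambda>d. d)"
proof (rule relaxed_projection.intro[OF piecewise_projection_axioms relaxed_projection_axioms.intro])
  fix i d assume i: "i \<in> I" and d: "(d::'a) \<noteq> 0"
  show "(1 - t) * norm (d - l *\<^sub>R H d) + t * norm (P i d) < norm d"
  proof (cases "H d = 0")
    case True
    then have "norm (P i d) < norm d"
      using transversal[OF i True] norm_P_le[OF i, of d] d by fastforce
    then have "t * norm (P i d) < t * norm d" using t by simp
    then show ?thesis using True by (simp add: algebra_simps)
  next
    case False
    have "(1 - t) * norm (d - l *\<^sub>R H d) < (1 - t) * norm d"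
      using gradient_step_strict[OF l False] t by simp
    moreover have "t * norm (P i d) \<le> t * norm d"
      using norm_P_le[OF i, of d] t by simp
    ultimately show ?thesis by (simp add: algebra_simps)
  qed
qed (use t linear_gradient_step gradient_step_diff linear_ident in auto)

text \<open>Here \<open>P i\<close> acts after the gradient step, so the projected term alone is
  strictly shorter in both cases. This admits \<open>t = 1\<close>, the value for projected
  gradients.\<close>

lemma relaxed_projection_gradient:
  assumes l: "0 < l" "l * L \<le> 1" and t: "0 < t" "t \<le> 1"
  shows "relaxed_projection I R P t (gradient_step l) (gradient_step l)
    (\<lambda>d. d - l *\<^sub>R H d) (\<lambda>d. d - l *\<^sub>R H d)"
proof (rule relaxed_projection.intro[OF piecewise_projection_axioms relaxed_projection_axioms.intro])
  fix i d assume i: "i \<in> I" and d: "(d::'a) \<noteq> 0"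
  let ?G = "d - l *\<^sub>R H d"
  have "norm (P i ?G) < norm d"
  proof (cases "H d = 0")
    case True
    then show ?thesis
      using transversal[OF i True] norm_P_le[OF i, of d] d by fastforce
  next
    case False
    then show ?thesis
      using gradient_step_strict[OF l False] norm_P_le[OF i, of ?G] by linarith
  qed
  then have "t * norm (P i ?G) < t * norm d" using t by simp
  moreover have "(1 - t) * norm ?G \<le> (1 - t) * norm d"
    using gradient_step_nonexpansive[OF l] t by (intro mult_left_mono) auto
  ultimately show "(1 - t) * norm ?G + t * norm (P i ?G) < norm d"
    by (simp add: algebra_simps)
qed (use t linear_gradient_step gradient_step_diff linear_ident in auto)

text \<open>With the projection \<open>z\<close> of the current point frozen, the iteration is a
  proximal gradient step for \<open>quad\<close> plus half the squared distance to \<open>z\<close>,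
  a function lying above the energy and touching it at the current point.\<close>

theorem proximal_difference_convergence:
  assumes l: "0 < l" "l * L \<le> 1"
    and T: "T = relaxed_proj S (l / (1 + l)) (gradient_step l) (\<lambda>w. w)"
    and gen: "generated_by T w"
  shows "\<exists>ws. accumulation_point w ws \<and> ws \<in> Fix T"
    and "\<lbrakk>accumulation_point w ws; ws \<in> Fix T; single_valued_at T ws\<rbrakk>
      \<Longrightarrow> w \<longlonglongrightarrow> ws \<and> locally_linear w ws"
proof -
  interpret relaxed_projection I R P "l / (1 + l)" "gradient_step l" "\<lambda>w. w" "\<lambda>d. d - l *\<^sub>R H d" "\<lambda>d. d"
    by (rule relaxed_projection_identity) (use l in auto)
  obtain B where B: "\<And>k. norm (w k) \<le> B"
    using generated_bounded[OF gen[unfolded T]] by (auto simp: bounded_iff)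
  have "energy (w (Suc k)) \<le> energy (w k) - 1/2 * (norm (w (Suc k) - w k))\<^sup>2" for k
  proof -
    obtain z where z: "z \<in> proj S (w k)"
      and w': "w (Suc k) = (1 - l / (1 + l)) *\<^sub>R gradient_step l (w k) + (l / (1 + l)) *\<^sub>R z"
      using gen by (auto simp: generated_by_def T relaxed_proj_def)
    define h where "h = w (Suc k) - w k"
    define g where "g = H (w k) - c"
    have h: "w (Suc k) = w k + h" by (simp add: h_def)
    have scale: "(1 + l) * (1 - l / (1 + l)) = 1" "(1 + l) * (l / (1 + l)) = l"
      using l by (auto simp: field_simps)
    have "(1 + l) *\<^sub>R w (Suc k) = ((1 + l) * (1 - l / (1 + l))) *\<^sub>R (w k - l *\<^sub>R g) + ((1 + l) * (l / (1 + l))) *\<^sub>R z"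
      unfolding w' g_def by (simp only: scaleR_add_right scaleR_scaleR)
    \<comment> \<open>Implicit form of the step: the pull towards \<open>z\<close> is evaluated at
      the new point \<open>w k + h\<close>, the gradient \<open>g\<close> at the old one.\<close>
    then have "h = l *\<^sub>R (z - w k - h - g)"
      unfolding h scale by (simp add: algebra_simps)
    then have "h \<bullet> h = l * ((z - w k - h - g) \<bullet> h)"
      by (metis inner_scaleR_left)
    then have gh: "g \<bullet> h = (z - w k) \<bullet> h - h \<bullet> h - h \<bullet> h / l"
      using l by (simp add: field_simps inner_diff_left inner_add_left)
    have "energy (w (Suc k)) \<le> quad (w k + h) + 1/2 * (norm (w k + h - z))\<^sup>2"
      using energy_le[of z "w (Suc k)"] z unfolding h by (auto simp: proj_iff)
    also have "\<dots> \<le> quad (w k) + g \<bullet> h + L / 2 * (norm h)\<^sup>2 + 1/2 * (norm (w k + h - z))\<^sup>2"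
      using quad_step[of "w k" h] by (simp add: g_def)
    also have "(norm (w k + h - z))\<^sup>2 = (norm (w k - z))\<^sup>2 - 2 * ((z - w k) \<bullet> h) + h \<bullet> h"
      unfolding dot_square_norm[symmetric] by (simp add: algebra_simps inner_commute)
    \<comment> \<open>The extra half of \<open>(norm h)\<^sup>2\<close> comes from the strong
      convexity of the distance term; the remaining coefficient is nonnegative even when
      \<open>l * L = 1\<close>.\<close>
    also have "quad (w k) + g \<bullet> h + L / 2 * (norm h)\<^sup>2
        + 1/2 * ((norm (w k - z))\<^sup>2 - 2 * ((z - w k) \<bullet> h) + h \<bullet> h)
      = energy (w k) - 1/2 * (norm h)\<^sup>2 - (1 / l - L / 2) * (norm h)\<^sup>2"
      unfolding gh energy_eq[OF z] by (simp add: dot_square_norm algebra_simps)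
    also have "\<dots> \<le> energy (w k) - 1/2 * (norm h)\<^sup>2"
    proof -
      have "L \<le> 1 / l" using l by (simp add: field_simps)
      then have "0 \<le> 1 / l - L / 2" using L_pos by linarith
      then show ?thesis by simp
    qed
    finally show ?thesis by (simp add: h_def)
  qed
  then have "(\<lambda>k. w (Suc k) - w k) \<longlonglongrightarrow> 0"
    by (intro vanishing_steps[where a = "1/2" and e = "\<lambda>k. energy (w k)", OF _ _ energy_lower[OF B]]) auto
  from accumulation_point_in_Fix[OF gen[unfolded T] this]
  show "\<exists>ws. accumulation_point w ws \<and> ws \<in> Fix T" by (simp only: T)
  show "\<lbrakk>accumulation_point w ws; ws \<in> Fix T; single_valued_at T ws\<rbrakk>
      \<Longrightarrow> w \<longlonglongrightarrow> ws \<and> locally_linear w ws"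
    using local_linear_convergence[OF gen[unfolded T]] unfolding T .
qed

text \<open>The relaxed projection of \<open>u\<close> is a proximal point of half the squared
  distance to \<open>S\<close>, so the iteration is a proximal gradient method for the
  energy.\<close>

theorem forward_backward_convergence:
  assumes l: "0 < l" "l * L < 1"
    and T: "T = relaxed_proj S (l / (1 + l)) (gradient_step l) (gradient_step l)"
    and gen: "generated_by T w"
  shows "\<exists>ws. accumulation_point w ws \<and> ws \<in> Fix T"
    and "\<lbrakk>accumulation_point w ws; ws \<in> Fix T; single_valued_at T ws\<rbrakk>
      \<Longrightarrow> w \<longlonglongrightarrow> ws \<and> locally_linear w ws"
proof -
  interpret relaxed_projection I R P "l / (1 + l)" "gradient_step l" "gradient_step l"
    "\<lambda>d. d - l *\<^sub>R H d" "\<lambda>d. d - l *\<^sub>R H d"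
    by (rule relaxed_projection_gradient) (use l in auto)
  obtain B where B: "\<And>k. norm (w k) \<le> B"
    using generated_bounded[OF gen[unfolded T]] by (auto simp: bounded_iff)
  \<comment> \<open>Half the difference between the curvature \<open>1 / l\<close> of the proximal
    model and the bound \<open>L\<close>; it is positive because \<open>l * L < 1\<close>.\<close>
  define a where "a = 1 / (2 * l) - L / 2"
  have a: "0 < a" using l by (simp add: a_def field_simps)
  have "energy (w (Suc k)) \<le> energy (w k) - a * (norm (w (Suc k) - w k))\<^sup>2" for k
  proof -
    define h where "h = w (Suc k) - w k"
    define g where "g = H (w k) - c"
    define u where "u = w k - l *\<^sub>R g"
    have h: "w (Suc k) = w k + h" by (simp add: h_def)
    obtain z where z: "z \<in> proj S u"
      and w': "w (Suc k) = (1 - l / (1 + l)) *\<^sub>R u + (l / (1 + l)) *\<^sub>R z"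
      using gen by (auto simp: generated_by_def T relaxed_proj_def u_def g_def)
    obtain y where y: "y \<in> proj S (w k)"
      using proj_nonempty[OF closed_S S_nonempty] by blast
    have zS: "z \<in> S" and uz: "norm (u - z) \<le> norm (u - y)"
      using z y by (auto simp: proj_iff)
    \<comment> \<open>The left side is the minimum of the right side over \<open>x\<close>. The
      proof squares \<open>(x - p) + l *\<^sub>R (x - q)\<close>, which vanishes at the
      minimizer.\<close>
    have split: "(norm (p - q))\<^sup>2 / (1 + l) \<le> (norm (x - p))\<^sup>2 / l + (norm (x - q))\<^sup>2" for x p q :: 'a
    proof -
      define d where "d = (x - p) \<bullet> (x - q)"
      have "(norm (a' + l *\<^sub>R b'))\<^sup>2
          = (norm a')\<^sup>2 + 2 * l * (a' \<bullet> b') + l * l * (norm b')\<^sup>2" for a' b' :: 'a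
        unfolding dot_square_norm[symmetric] by (simp add: algebra_simps inner_commute)
      from this[of "x - p" "x - q"] have "(norm ((x - p) + l *\<^sub>R (x - q)))\<^sup>2
          = (norm (x - p))\<^sup>2 + 2 * l * d + l * l * (norm (x - q))\<^sup>2" by (simp only: d_def)
      then have "0 \<le> (norm (x - p))\<^sup>2 + 2 * l * d + l * l * (norm (x - q))\<^sup>2"
        by (metis zero_le_power2)
      moreover have "(norm (p - q))\<^sup>2 = (norm (x - p))\<^sup>2 + (norm (x - q))\<^sup>2 - 2 * d"
        unfolding dot_square_norm[symmetric] d_def by (simp add: algebra_simps inner_commute)
      then have "l * (norm (p - q))\<^sup>2 = l * ((norm (x - p))\<^sup>2 + (norm (x - q))\<^sup>2 - 2 * d)"
        by simp
      ultimately have "l * (norm (p - q))\<^sup>2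
          \<le> (1 + l) * ((norm (x - p))\<^sup>2 + l * (norm (x - q))\<^sup>2)"
        by (simp add: algebra_simps)
      then show ?thesis using l by (simp add: field_simps)
    qed
    have up: "w (Suc k) - u = - (l / (1 + l)) *\<^sub>R (u - z)"
      unfolding w' by (simp add: algebra_simps)
    have zp: "w (Suc k) - z = (1 / (1 + l)) *\<^sub>R (u - z)"
    proof -
      have "1 - l / (1 + l) = 1 / (1 + l)" using l by (simp add: field_simps)
      moreover have "w (Suc k) - z = (1 - l / (1 + l)) *\<^sub>R (u - z)"
        unfolding w' by (simp add: algebra_simps)
      ultimately show ?thesis by simp
    qed
    \<comment> \<open>The new iterate attains equality in \<open>split\<close> for \<open>u\<close>
      and \<open>z\<close>; minimality of \<open>z\<close> against \<open>y\<close> then allows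
      comparison with the old iterate.\<close>
    have "(norm (w (Suc k) - u))\<^sup>2 / l + (norm (w (Suc k) - z))\<^sup>2
        = ((l / (1 + l))\<^sup>2 / l + (1 / (1 + l))\<^sup>2) * (norm (u - z))\<^sup>2"
      unfolding up zp norm_scaleR power_mult_distrib power2_abs power2_minus by (simp add: distrib_right)
    also have "(l / (1 + l))\<^sup>2 / l + (1 / (1 + l))\<^sup>2 = 1 / (1 + l)"
    proof -
      have "(l / (1 + l))\<^sup>2 / l + (1 / (1 + l))\<^sup>2 = (l + 1) / (1 + l)\<^sup>2"
        using l by (simp add: power_divide add_divide_distrib power2_eq_square)
      also have "\<dots> = 1 / (1 + l)" using l by (simp add: power2_eq_square add.commute[of l])
      finally show ?thesis .
    qed
    also have "1 / (1 + l) * (norm (u - z))\<^sup>2 \<le> (norm (u - y))\<^sup>2 / (1 + l)"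
      using uz l by (simp add: divide_right_mono power_mono)
    also have "\<dots> \<le> (norm (w k - u))\<^sup>2 / l + (norm (w k - y))\<^sup>2" by (rule split)
    finally have main: "(norm (w (Suc k) - u))\<^sup>2 / l + (norm (w (Suc k) - z))\<^sup>2
      \<le> (norm (w k - u))\<^sup>2 / l + (norm (w k - y))\<^sup>2" .
    \<comment> \<open>Expanding around \<open>w k\<close> turns the two distances to
      \<open>u\<close> into the linear model \<open>g \<bullet> h\<close> plus a quadratic
      penalty.\<close>
    have "(norm (w (Suc k) - u))\<^sup>2 = (norm h)\<^sup>2 + 2 * l * (g \<bullet> h) + (norm (w k - u))\<^sup>2"
      unfolding dot_square_norm[symmetric] h u_def by (simp add: algebra_simps inner_commute)
    then have "(norm (w (Suc k) - u))\<^sup>2 / l = (norm h)\<^sup>2 / l + 2 * (g \<bullet> h) + (norm (w k - u))\<^sup>2 / l"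
      using l by (simp add: add_divide_distrib)
    with main have "(norm h)\<^sup>2 / l + 2 * (g \<bullet> h) + (norm (w (Suc k) - z))\<^sup>2 \<le> (norm (w k - y))\<^sup>2"
      by linarith
    moreover have "quad (w (Suc k)) \<le> quad (w k) + g \<bullet> h + L / 2 * (norm h)\<^sup>2"
      using quad_step[of "w k" h] by (simp add: g_def h)
    moreover have "a * (norm h)\<^sup>2 = (norm h)\<^sup>2 / l / 2 - L / 2 * (norm h)\<^sup>2"
      by (simp add: a_def algebra_simps)
    ultimately show ?thesis
      using energy_le[OF zS, of "w (Suc k)"] energy_eq[OF y] by (simp add: h_def[symmetric])
  qed
  then have "(\<lambda>k. w (Suc k) - w k) \<longlonglongrightarrow> 0"
    using a by (intro vanishing_steps[where a = a and e = "\<lambda>k. energy (w k)", OF _ _ energy_lower[OF B]]) auto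
  from accumulation_point_in_Fix[OF gen[unfolded T] this]
  show "\<exists>ws. accumulation_point w ws \<and> ws \<in> Fix T" by (simp only: T)
  show "\<lbrakk>accumulation_point w ws; ws \<in> Fix T; single_valued_at T ws\<rbrakk>
      \<Longrightarrow> w \<longlonglongrightarrow> ws \<and> locally_linear w ws"
    using local_linear_convergence[OF gen[unfolded T]] unfolding T .
qed

text \<open>Iterates lie in \<open>S\<close> after the first step, so the previous iterate competes
  in the next projection and \<open>quad\<close> alone decreases.\<close>

theorem projected_gradient_convergence:
  assumes l: "0 < l" "l * L < 1"
    and T: "T = relaxed_proj S 1 (gradient_step l) (gradient_step l)"
    and gen: "generated_by T w"
  shows "\<exists>ws. accumulation_point w ws \<and> ws \<in> Fix T"
    and "\<lbrakk>accumulation_point w ws; ws \<in> Fix T; single_valued_at T ws\<rbrakk>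
      \<Longrightarrow> w \<longlonglongrightarrow> ws \<and> locally_linear w ws"
proof -
  interpret relaxed_projection I R P 1 "gradient_step l" "gradient_step l"
    "\<lambda>d. d - l *\<^sub>R H d" "\<lambda>d. d - l *\<^sub>R H d"
    by (rule relaxed_projection_gradient) (use l in auto)
  obtain B where B: "\<And>k. norm (w k) \<le> B"
    using generated_bounded[OF gen[unfolded T]] by (auto simp: bounded_iff)
  define a where "a = 1 / (2 * l) - L / 2"
  have a: "0 < a" using l by (simp add: a_def field_simps)
  have step: "w (Suc k) \<in> proj S (gradient_step l (w k))" for k
    using gen by (auto simp: generated_by_def T relaxed_proj_def)
  \<comment> \<open>Indices are shifted by one because \<open>w 0\<close> may lie outside
    \<open>S\<close>.\<close>
  have "quad (w (Suc (Suc k))) \<le> quad (w (Suc k)) - a * (norm (w (Suc (Suc k)) - w (Suc k)))\<^sup>2" for k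
  proof -
    define h where "h = w (Suc (Suc k)) - w (Suc k)"
    define g where "g = H (w (Suc k)) - c"
    have h: "w (Suc (Suc k)) = w (Suc k) + h" by (simp add: h_def)
    have "w (Suc k) \<in> S" using step[of k] by (auto simp: proj_iff)
    then have "norm (w (Suc k) - l *\<^sub>R g - w (Suc (Suc k))) \<le> norm (w (Suc k) - l *\<^sub>R g - w (Suc k))"
      using step[of "Suc k"] unfolding proj_iff g_def by blast
    then have "norm (h + l *\<^sub>R g) \<le> norm (l *\<^sub>R g)"
      unfolding h by (simp add: norm_minus_commute[of "- (l *\<^sub>R g)" h] del: norm_scaleR)
    then have "(h + l *\<^sub>R g) \<bullet> (h + l *\<^sub>R g) \<le> (l *\<^sub>R g) \<bullet> (l *\<^sub>R g)"
      by (simp only: norm_le)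
    then have "(norm h)\<^sup>2 + l * (2 * (g \<bullet> h)) \<le> 0"
      unfolding dot_square_norm[symmetric] by (simp add: algebra_simps inner_commute)
    then have "(norm h)\<^sup>2 / l + 2 * (g \<bullet> h) \<le> 0"
      using l by (simp add: field_simps)
    moreover have "quad (w (Suc (Suc k))) \<le> quad (w (Suc k)) + g \<bullet> h + L / 2 * (norm h)\<^sup>2"
      using quad_step[of "w (Suc k)" h] by (simp add: g_def h)
    moreover have "a * (norm h)\<^sup>2 = (norm h)\<^sup>2 / l / 2 - L / 2 * (norm h)\<^sup>2"
      by (simp add: a_def algebra_simps)
    ultimately show ?thesis by (simp add: h_def[symmetric])
  qed
  then have "(\<lambda>k. w (Suc (Suc k)) - w (Suc k)) \<longlonglongrightarrow> 0"
    using a by (intro vanishing_steps[where a = a and e = "\<lambda>k. quad (w (Suc k))", OF _ _ quad_lower[OF B]]) auto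
  then have "(\<lambda>k. w (Suc k) - w k) \<longlonglongrightarrow> 0"
    by (rule LIMSEQ_imp_Suc)
  from accumulation_point_in_Fix[OF gen[unfolded T] this]
  show "\<exists>ws. accumulation_point w ws \<and> ws \<in> Fix T" by (simp only: T)
  show "\<lbrakk>accumulation_point w ws; ws \<in> Fix T; single_valued_at T ws\<rbrakk>
      \<Longrightarrow> w \<longlonglongrightarrow> ws \<and> locally_linear w ws"
    using local_linear_convergence[OF gen[unfolded T]] unfolding T .
qed

end


section \<open>The linear complementarity problem\<close>

definition lcp_piece :: "'n set \<Rightarrow> (real^('n::finite + 'n)) set" where
  "lcp_piece J = {w. \<forall>j. if j \<in> J then 0 \<le> w $ Inl j \<and> w $ Inr j = 0
     else w $ Inl j = 0 \<and> 0 \<le> w $ Inr j}"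

text \<open>The orthogonal projector onto the linear span of \<open>lcp_piece J\<close>.\<close>

definition lcp_support :: "'n set \<Rightarrow> real^('n::finite + 'n) \<Rightarrow> real^('n + 'n)" where
  "lcp_support J w = (\<chi> k. case k of Inl j \<Rightarrow> if j \<in> J then w $ Inl j else 0
     | Inr j \<Rightarrow> if j \<in> J then 0 else w $ Inr j)"

lemma lcp_support_nth [simp]:
  "lcp_support J w $ Inl j = (if j \<in> J then w $ Inl j else 0)"
  "lcp_support J w $ Inr j = (if j \<in> J then 0 else w $ Inr j)"
  by (simp_all add: lcp_support_def)

lemma lcp_matrix_nth:
  "lcp_matrix M $ i $ Inl k = M $ i $ k" "lcp_matrix M $ i $ Inr k = (if i = k then - 1 else 0)"
  by (simp_all add: lcp_matrix_def mat_def)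

lemma vec_sum_eq_iff:
  fixes x y :: "'a^('n::finite + 'm::finite)"
  shows "x = y \<longleftrightarrow> (\<forall>j. x $ Inl j = y $ Inl j) \<and> (\<forall>j. x $ Inr j = y $ Inr j)"
  by (metis vec_eq_iff sum.exhaust)

lemma inner_vec_sum:
  fixes x y :: "real^('n::finite + 'm::finite)"
  shows "x \<bullet> y = (\<Sum>j\<in>UNIV. x $ Inl j * y $ Inl j) + (\<Sum>j\<in>UNIV. x $ Inr j * y $ Inr j)"
  by (simp add: inner_vec_def UNIV_Plus_UNIV[symmetric] sum.Plus del: UNIV_Plus_UNIV)

lemma S2_eq_Union: "S2 = (\<Union>J\<in>UNIV. lcp_piece J)"
proof (intro set_eqI iffI)
  fix w :: "real^('n::finite + 'n)" assume "w \<in> S2"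
  \<comment> \<open>Where the second block is nonzero, complementarity forces the first to
    vanish.\<close>
  then have "w \<in> lcp_piece {j. w $ Inr j = 0}"
    by (auto simp: S2_def lcp_piece_def)
  then show "w \<in> (\<Union>J\<in>UNIV. lcp_piece J)" by blast
next
  fix w :: "real^('n::finite + 'n)" assume "w \<in> (\<Union>J\<in>UNIV. lcp_piece J)"
  then obtain J where J: "w \<in> lcp_piece J" by blast
  have "0 \<le> w $ Inl j \<and> 0 \<le> w $ Inr j \<and> w $ Inl j * w $ Inr j = 0" for j
    using J by (cases "j \<in> J") (auto simp: lcp_piece_def dest: spec[of _ j])
  then show "w \<in> S2" by (simp add: S2_def)
qed

lemma closed_lcp_piece: "closed (lcp_piece J)"
  unfolding lcp_piece_def
proof (rule closed_Collect_all)
  fix j :: 'a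
  show "closed {w::real^('a + 'a). if j \<in> J then 0 \<le> w $ Inl j \<and> w $ Inr j = 0
     else w $ Inl j = 0 \<and> 0 \<le> w $ Inr j}"
    by (cases "j \<in> J")
      (auto intro!: closed_Collect_conj closed_Collect_le closed_Collect_eq continuous_intros)
qed

lemma convex_lcp_piece: "convex (lcp_piece J)"
  unfolding lcp_piece_def convex_def
  by (auto split: if_splits)

lemma inner_lcp_support:
  assumes "y \<in> lcp_piece J" "z \<in> lcp_piece J"
  shows "x \<bullet> (y - z) = lcp_support J x \<bullet> (y - z)"
proof -
  have "y $ Inl j = 0 \<and> z $ Inl j = 0" if "j \<notin> J" for j
    using assms that by (auto simp: lcp_piece_def)
  moreover have "y $ Inr j = 0 \<and> z $ Inr j = 0" if "j \<in> J" for j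
    using assms that by (auto simp: lcp_piece_def)
  ultimately show ?thesis
    unfolding inner_vec_sum by (intro arg_cong2[where f = "(+)"] sum.cong) auto
qed

text \<open>Besides the norm bound, Pythagoras shows that equality of norms places \<open>x\<close>
  in the coordinate subspace.\<close>

lemma norm_lcp_support:
  "(norm x)\<^sup>2 = (norm (lcp_support J x))\<^sup>2 + (norm (x - lcp_support J x))\<^sup>2"
proof -
  have "lcp_support J x \<bullet> (x - lcp_support J x) = 0"
    unfolding inner_vec_sum by (auto simp: sum.neutral)
  from norm_add_Pythagorean[of "lcp_support J x" "x - lcp_support J x"] this show ?thesis
    by (simp add: orthogonal_def)
qed

lemma lcp_piecewise_projection: "piecewise_projection UNIV lcp_piece lcp_support"
proof unfold_locales
  fix J :: "'n::finite set" and x y z :: "real^('n + 'n)"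
  have "0 \<in> lcp_piece J" by (simp add: lcp_piece_def)
  then show "lcp_piece J \<noteq> {}" by blast
  show "norm (lcp_support J x) \<le> norm x"
    using norm_lcp_support[of x J] by (simp add: power2_le_imp_le)
  show "x \<bullet> (y - z) = lcp_support J x \<bullet> (y - z)" if "y \<in> lcp_piece J" "z \<in> lcp_piece J"
    using that by (rule inner_lcp_support)
qed (simp_all add: closed_lcp_piece convex_lcp_piece vec_sum_eq_iff)

text \<open>A permutation moving an index outside \<open>S\<close> meets an off-diagonal zero of an
  identity row, so only permutations of \<open>S\<close> survive in the Leibniz sum. The minor
  thereby becomes a determinant on the full index type.\<close>

lemma principal_minor_eq_det_replace_rows:
  fixes M :: "real^'n^'n::finite"
  shows "principal_minor M S = det (\<chi> i j. if i \<in> S then M $ i $ j else mat 1 $ i $ j)"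
proof -
  let ?N = "(\<chi> i j. if i \<in> S then M $ i $ j else mat 1 $ i $ j) :: real^'n^'n"
  have "det ?N = (\<Sum>p | p permutes S. of_int (sign p) * (\<Prod>i\<in>UNIV. ?N $ i $ p i))"
    unfolding det_def
  proof (rule sum.mono_neutral_right)
    show "{p. p permutes S} \<subseteq> {p. p permutes UNIV}"
      using permutes_subset by blast
    show "\<forall>p\<in>{p. p permutes UNIV} - {p. p permutes S}.
        of_int (sign p) * (\<Prod>i\<in>UNIV. ?N $ i $ p i) = 0"
    proof
      fix p assume p: "p \<in> {p. p permutes UNIV} - {p. p permutes S}"
      then obtain i where "i \<notin> S" "p i \<noteq> i"
        by (auto simp: permutes_def)
      then have "?N $ i $ p i = 0" by (simp add: mat_def)
      then have "(\<Prod>i\<in>UNIV. ?N $ i $ p i) = 0" by (intro prod_zero bexI[of _ i]) simp_all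
      then show "of_int (sign p) * (\<Prod>i\<in>UNIV. ?N $ i $ p i) = 0" by simp
    qed
  qed simp
  also have "\<dots> = principal_minor M S"
    unfolding principal_minor_def
  proof (rule sum.cong[OF refl])
    fix p assume "p \<in> {p. p permutes S}"
    then have "p i = i" if "i \<notin> S" for i using that by (auto simp: permutes_def)
    then have "(\<Prod>i\<in>UNIV. ?N $ i $ p i) = (\<Prod>i\<in>S. M $ i $ p i)"
      by (intro prod.mono_neutral_cong_right) (auto simp: mat_def)
    then show "of_int (sign p) * (\<Prod>i\<in>UNIV. ?N $ i $ p i) = of_int (sign p) * (\<Prod>i\<in>S. M $ i $ p i)"
      by simp
  qed
  finally show ?thesis by simp
qed

text \<open>Rows of \<open>M\<close> on \<open>S\<close> and identity rows elsewhere form a matrix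
  that annihilates \<open>x\<close> and whose determinant is a principal minor.\<close>

lemma nondegenerate_trivial_kernel:
  fixes M :: "real^'n^'n::finite"
  assumes M: "nondegenerate M" and x: "\<And>i. i \<notin> S \<Longrightarrow> x $ i = 0"
    and Mx: "\<And>i. i \<in> S \<Longrightarrow> (M *v x) $ i = 0"
  shows "x = 0"
proof (cases "S = {}")
  case True
  then show ?thesis using x by (simp add: vec_eq_iff)
next
  case False
  let ?N = "(\<chi> i j. if i \<in> S then M $ i $ j else mat 1 $ i $ j) :: real^'n^'n"
  have "det ?N \<noteq> 0"
    using M False by (simp add: nondegenerate_def principal_minor_eq_det_replace_rows)
  then have "\<exists>B. B ** ?N = mat 1"
    using invertible_det_nz invertible_left_inverse by blast
  moreover have "?N *v x = 0"
  proof (subst vec_eq_iff, intro allI)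
    fix i
    show "(?N *v x) $ i = 0 $ i"
    proof (cases "i \<in> S")
      case True
      then show ?thesis using Mx[OF True] by (simp add: matrix_vector_mult_def)
    next
      case False
      then have "(?N *v x) $ i = (mat 1 *v x) $ i" by (simp add: matrix_vector_mult_def)
      then show ?thesis using x[OF False] by simp
    qed
  qed
  ultimately show ?thesis using matrix_left_invertible_ker by blast
qed

section \<open>Kernels of the constraint matrix and of its transpose\<close>

lemma lcp_matrix_mult_nth: "(lcp_matrix M *v w) $ i = (M *v (\<chi> j. w $ Inl j)) $ i - w $ Inr i"
  by (simp add: lcp_matrix_nth matrix_vector_mult_def UNIV_Plus_UNIV[symmetric] sum.Plus
      mult_delta_left del: UNIV_Plus_UNIV)

lemma transpose_lcp_matrix_mult_Inr: "(transpose (lcp_matrix M) *v y) $ Inr i = - y $ i"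
  by (simp add: lcp_matrix_nth matrix_vector_mult_def transpose_def mult_delta_left
      del: transpose_matrix_vector)

lemma transpose_lcp_matrix_ker: "transpose (lcp_matrix M) *v y = 0 \<Longrightarrow> y = 0"
  by (metis transpose_lcp_matrix_mult_Inr neg_equal_0_iff_equal vec_eq_iff zero_index)

text \<open>Nondegeneracy enters here. Equal norms place \<open>w\<close> in the coordinate subspace
  of \<open>J\<close>, and the kernel equation reads \<open>y = M x\<close>; so \<open>x\<close>
  vanishes off \<open>J\<close> and \<open>M x\<close> on \<open>J\<close>.\<close>

lemma lcp_matrix_ker_support:
  assumes M: "nondegenerate M" and ker: "lcp_matrix M *v w = 0"
    and supp: "norm (lcp_support J w) = norm w"
  shows "w = 0"
proof -
  have "lcp_support J w = w"
    using norm_lcp_support[of w J] supp by simp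
  then have zero: "j \<notin> J \<Longrightarrow> w $ Inl j = 0" "j \<in> J \<Longrightarrow> w $ Inr j = 0" for j
    using lcp_support_nth by metis+
  have row: "(M *v (\<chi> j. w $ Inl j)) $ i = w $ Inr i" for i
    using lcp_matrix_mult_nth[of M w i] ker by simp
  have x0: "(\<chi> j. w $ Inl j) = (0 :: real^'a)"
    by (rule nondegenerate_trivial_kernel[OF M, of J]) (auto simp: zero row)
  then have "w $ Inl j = 0" for j by (simp add: vec_eq_iff)
  moreover have "w $ Inr j = 0" for j
    using row[of j] unfolding x0 by simp
  ultimately show ?thesis by (simp add: vec_sum_eq_iff)
qed

lemma inner_transpose_mult:
  fixes A :: "real^'m^'n"
  shows "u \<bullet> (transpose A *v v) = (A *v u) \<bullet> v"
  by (metis dot_lmul_matrix inner_commute transpose_matrix_vector)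

section \<open>The complementarity problem as an instance of quadratic feasibility\<close>

lemma lcp_quadratic_feasibility:
  fixes M Q :: "real^'n^'n::finite"
  defines "A \<equiv> lcp_matrix M"
  defines "H \<equiv> \<lambda>w. transpose A *v (Q *v (A *v w))"
  assumes M: "nondegenerate M" and sym: "\<And>x y. x \<bullet> (Q *v y) = (Q *v x) \<bullet> y"
    and inj: "\<And>x. Q *v x = 0 \<Longrightarrow> x = 0"
    and bound: "\<And>w. (norm (H w))\<^sup>2 \<le> L * (w \<bullet> H w)" and L: "0 < L"
  shows "quadratic_feasibility UNIV lcp_piece lcp_support H L"
proof -
  interpret piecewise_projection UNIV lcp_piece lcp_support
    by (rule lcp_piecewise_projection)
  show ?thesis
  proof unfold_locales
    have "x \<bullet> H y = (A *v x) \<bullet> (Q *v (A *v y))" for x y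
      by (simp only: H_def inner_transpose_mult)
    then show "x \<bullet> H y = H x \<bullet> y" for x y
      by (metis inner_commute sym)
    \<comment> \<open>Both \<open>transpose A\<close> and \<open>Q\<close> are injective, so
      \<open>H w = 0\<close> forces \<open>A *v w = 0\<close>.\<close>
    fix J :: "'n set" and w assume "H w = 0" "norm (lcp_support J w) = norm w"
    then show "w = 0"
      using lcp_matrix_ker_support[OF M] transpose_lcp_matrix_ker inj
      unfolding H_def A_def by blast
  qed (auto simp: H_def matrix_vector_right_distrib bound[unfolded H_def] L
      scaleR_matrix_vector_assoc[symmetric] matrix_vector_mult_scaleR simp del: transpose_matrix_vector)
qed

text \<open>For the inverse of \<open>A ** transpose A\<close> the map is the orthogonal projector
  onto the row space of \<open>A\<close>, so cocoercivity holds with equality and constant 1. For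
  \<open>Q = mat 1\<close> it follows from the operator norm bound for
  \<open>transpose A\<close>.\<close>

lemma lcp_preconditioner:
  fixes M Q :: "real^'n^'n::finite"
  defines "A \<equiv> lcp_matrix M"
  assumes M: "nondegenerate M" and L: "0 < L"
    and Q: "(Q, L) \<in> {(matrix_inv (A ** transpose A), 1), (mat 1, (onorm ((*v) A))\<^sup>2)}"
  shows "quadratic_feasibility UNIV lcp_piece lcp_support (\<lambda>w. transpose A *v (Q *v (A *v w))) L"
  using Q
proof (elim insertE emptyE)
  assume "(Q, L) = (matrix_inv (A ** transpose A), 1)"
  then have Q: "Q = matrix_inv (A ** transpose A)" and L1: "L = 1" by auto
  define B where "B = A ** transpose A"
  have B: "B *v y = A *v (transpose A *v y)" for y
    by (simp add: B_def matrix_vector_mul_assoc del: transpose_matrix_vector)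
  have symB: "x \<bullet> (B *v y) = (B *v x) \<bullet> y" for x y
    unfolding B by (metis inner_transpose_mult inner_commute)
  have "y = 0" if "B *v y = 0" for y
  proof -
    have "(transpose A *v y) \<bullet> (transpose A *v y) = 0"
      using that unfolding B inner_transpose_mult by simp
    then show ?thesis using transpose_lcp_matrix_ker unfolding A_def by (metis inner_eq_zero_iff)
  qed
  then have "invertible B"
    using matrix_left_invertible_ker invertible_left_inverse by blast
  \<comment> \<open>\<open>matrix_inv\<close> is a choice term, so it is known to be an inverse only
    once invertibility is established.\<close>
  then have BQ: "B ** Q = mat 1"
    unfolding Q B_def[symmetric] invertible_def matrix_inv_def by (rule someI_ex[THEN conjunct1])
  then have BQ_cancel: "B *v (Q *v y) = y" for y
    by (simp add: matrix_vector_mul_assoc)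
  have sym: "x \<bullet> (Q *v y) = (Q *v x) \<bullet> y" for x y
    by (metis BQ_cancel symB)
  show ?thesis
    unfolding A_def
  proof (rule lcp_quadratic_feasibility[OF M sym _ _ L])
    show "x = 0" if "Q *v x = 0" for x using BQ_cancel[of x] that by simp
    show "(norm (transpose (lcp_matrix M) *v (Q *v (lcp_matrix M *v w))))\<^sup>2
        \<le> L * (w \<bullet> (transpose (lcp_matrix M) *v (Q *v (lcp_matrix M *v w))))" for w
      unfolding A_def[symmetric] L1 dot_square_norm[symmetric] inner_transpose_mult
      by (simp add: B[symmetric] BQ_cancel del: transpose_matrix_vector)
  qed
next
  assume "(Q, L) = (mat 1, (onorm ((*v) A))\<^sup>2)"
  then have Q: "Q = mat 1" and Lsq: "L = (onorm ((*v) A))\<^sup>2" by auto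
  have normA: "norm (A *v x) \<le> onorm ((*v) A) * norm x" for x
    by (rule onorm) simp
  \<comment> \<open>The bound for \<open>A\<close> passes to the transpose by duality, testing
    \<open>A *v ?x\<close> against \<open>y\<close>.\<close>
  have normAt: "norm (transpose A *v y) \<le> onorm ((*v) A) * norm y" for y
  proof -
    let ?x = "transpose A *v y"
    have "norm ?x * norm ?x = (A *v ?x) \<bullet> y"
      by (metis inner_transpose_mult dot_square_norm power2_eq_square)
    also have "\<dots> \<le> (onorm ((*v) A) * norm ?x) * norm y"
      using norm_cauchy_schwarz[of "A *v ?x" y] mult_right_mono[OF normA[of ?x] norm_ge_zero[of y]]
      by linarith
    finally have "norm ?x * norm ?x \<le> (onorm ((*v) A) * norm y) * norm ?x"
      by (simp only: ac_simps)
    then show ?thesis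
      using normA[of ?x] norm_ge_zero[of "A *v ?x"] by (cases "?x = 0")
        (auto simp: onorm_pos_le simp del: transpose_matrix_vector)
  qed
  show ?thesis
    unfolding A_def
  proof (rule lcp_quadratic_feasibility[OF M _ _ _ L])
    show "(norm (transpose (lcp_matrix M) *v (Q *v (lcp_matrix M *v w))))\<^sup>2
        \<le> L * (w \<bullet> (transpose (lcp_matrix M) *v (Q *v (lcp_matrix M *v w))))" for w
      using power_mono[OF normAt[of "A *v w"] norm_ge_zero, of 2]
      unfolding A_def[symmetric] Q Lsq inner_transpose_mult
      by (simp add: power_mult_distrib dot_square_norm del: transpose_matrix_vector)
  qed (auto simp: Q)
qed

section \<open>The three operators as relaxed projections, and the final assembly\<close>

lemma grad_f_Q_eq:
  "grad_f_Q A Q b w = transpose A *v (Q *v (A *v w)) - transpose A *v (Q *v b)"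
  by (simp add: grad_f_Q_def matrix_vector_mult_diff_distrib del: transpose_matrix_vector)

lemma T_PDMC_eq:
  assumes "0 < l"
  shows "T_PDMC A Q b l =
    relaxed_proj S2 (l / (1 + l)) (\<lambda>w. w - l *\<^sub>R grad_f_Q A Q b w) (\<lambda>w. w)"
proof -
  have "1 - l / (1 + l) = 1 / (1 + l)" using assms by (simp add: field_simps)
  then show ?thesis
    by (simp add: fun_eq_iff T_PDMC_def relaxed_proj_def scaleR_add_right)
qed

lemma T_FB_eq:
  assumes "0 < l"
  shows "T_FB A Q b l = relaxed_proj S2 (l / (1 + l))
    (\<lambda>w. w - l *\<^sub>R grad_f_Q A Q b w) (\<lambda>w. w - l *\<^sub>R grad_f_Q A Q b w)"
proof -
  have "1 - l / (1 + l) = 1 / (1 + l)" using assms by (simp add: field_simps)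
  then show ?thesis
    by (simp add: fun_eq_iff T_FB_def relaxed_proj_def add.commute)
qed

lemma T_PS_eq:
  "T_PS A Q b l = relaxed_proj S2 1
    (\<lambda>w. w - l *\<^sub>R grad_f_Q A Q b w) (\<lambda>w. w - l *\<^sub>R grad_f_Q A Q b w)"
  by (simp add: fun_eq_iff T_PS_def relaxed_proj_def)

text \<open>The pair \<open>(Q, L)\<close> ties each preconditioner to its constant. Convergence
  with its rate is claimed for every accumulation point that is a fixed point with single-valued
  image, not just for the one asserted to exist.\<close>

theorem theorem6p7:
  fixes M :: "real^'n^'n::finite" and b :: "real^'n"
    and A :: "real^('n + 'n)^'n" and Q :: "real^'n^'n" and L :: real
  assumes "nondegenerate M"
    and "A = lcp_matrix M"
    and "(Q, L) \<in> {(matrix_inv (A ** transpose A), 1), (mat 1, (onorm ((*v) A))\<^sup>2)}"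
  shows
    "(\<forall>l w. 0 < l \<and> l \<le> 1 / L \<and> generated_by (T_PDMC A Q b l) w \<longrightarrow>
        (\<exists>ws. accumulation_point w ws \<and> ws \<in> Fix (T_PDMC A Q b l)) \<and>
        (\<forall>ws. accumulation_point w ws \<and> ws \<in> Fix (T_PDMC A Q b l) \<and>
           single_valued_at (T_PDMC A Q b l) ws \<longrightarrow> w \<longlonglongrightarrow> ws \<and> locally_linear w ws))
   \<and> (\<forall>l w. 0 < l \<and> l < 1 / L \<and> generated_by (T_FB A Q b l) w \<longrightarrow>
        (\<exists>ws. accumulation_point w ws \<and> ws \<in> Fix (T_FB A Q b l)) \<and>
        (\<forall>ws. accumulation_point w ws \<and> ws \<in> Fix (T_FB A Q b l) \<and>
           single_valued_at (T_FB A Q b l) ws \<longrightarrow> w \<longlonglongrightarrow> ws \<and> locally_linear w ws))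
   \<and> (\<forall>l w. 0 < l \<and> l < 1 / L \<and> generated_by (T_PS A Q b l) w \<longrightarrow>
        (\<exists>ws. accumulation_point w ws \<and> ws \<in> Fix (T_PS A Q b l)) \<and>
        (\<forall>ws. accumulation_point w ws \<and> ws \<in> Fix (T_PS A Q b l) \<and>
           single_valued_at (T_PS A Q b l) ws \<longrightarrow> w \<longlonglongrightarrow> ws \<and> locally_linear w ws))"
proof -
  define H where "H = (\<lambda>w. transpose A *v (Q *v (A *v w)))"
  define c where "c = transpose A *v (Q *v b)"
  have grad: "grad_f_Q A Q b = (\<lambda>w. H w - c)"
    by (simp add: fun_eq_iff grad_f_Q_eq H_def c_def)
  \<comment> \<open>Division by zero yields zero, so the existence of an admissible step size
    already forces \<open>L\<close> to be positive.\<close>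
  have L: "0 < L" if "0 < l" "l \<le> 1 / L" for l
    using that by (metis less_le_trans zero_less_divide_1_iff)
  have qf: "quadratic_feasibility UNIV lcp_piece lcp_support H L" if "0 < L"
    using lcp_preconditioner[OF assms(1) that] assms(2,3) by (simp add: H_def)
  have PDMC: "(\<exists>ws. accumulation_point w ws \<and> ws \<in> Fix (T_PDMC A Q b l)) \<and>
      (\<forall>ws. accumulation_point w ws \<and> ws \<in> Fix (T_PDMC A Q b l) \<and>
         single_valued_at (T_PDMC A Q b l) ws \<longrightarrow> w \<longlonglongrightarrow> ws \<and> locally_linear w ws)"
    if l: "0 < l" "l \<le> 1 / L" and w: "generated_by (T_PDMC A Q b l) w" for l w
  proof -
    interpret quadratic_feasibility UNIV lcp_piece lcp_support H c L
      by (rule qf[OF L[OF l]])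
    have "l * L \<le> 1" using l L_pos by (simp add: pos_le_divide_eq)
    note * = proximal_difference_convergence[OF l(1) this T_PDMC_eq[where A = A and Q = Q and b = b, OF l(1), unfolded grad S2_eq_Union] w]
    show ?thesis using * by blast
  qed
  have FB: "(\<exists>ws. accumulation_point w ws \<and> ws \<in> Fix (T_FB A Q b l)) \<and>
      (\<forall>ws. accumulation_point w ws \<and> ws \<in> Fix (T_FB A Q b l) \<and>
         single_valued_at (T_FB A Q b l) ws \<longrightarrow> w \<longlonglongrightarrow> ws \<and> locally_linear w ws)"
    if l: "0 < l" "l < 1 / L" and w: "generated_by (T_FB A Q b l) w" for l w
  proof -
    interpret quadratic_feasibility UNIV lcp_piece lcp_support H c L
      by (rule qf[OF L[OF l(1) less_imp_le[OF l(2)]]])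
    have "l * L < 1" using l L_pos by (simp add: pos_less_divide_eq)
    note * = forward_backward_convergence[OF l(1) this T_FB_eq[where A = A and Q = Q and b = b, OF l(1), unfolded grad S2_eq_Union] w]
    show ?thesis using * by blast
  qed
  have PS: "(\<exists>ws. accumulation_point w ws \<and> ws \<in> Fix (T_PS A Q b l)) \<and>
      (\<forall>ws. accumulation_point w ws \<and> ws \<in> Fix (T_PS A Q b l) \<and>
         single_valued_at (T_PS A Q b l) ws \<longrightarrow> w \<longlonglongrightarrow> ws \<and> locally_linear w ws)"
    if l: "0 < l" "l < 1 / L" and w: "generated_by (T_PS A Q b l) w" for l w
  proof -
    interpret quadratic_feasibility UNIV lcp_piece lcp_support H c L
      by (rule qf[OF L[OF l(1) less_imp_le[OF l(2)]]])
    have "l * L < 1" using l L_pos by (simp add: pos_less_divide_eq)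
    note * = projected_gradient_convergence[OF l(1) this T_PS_eq[where A = A and Q = Q and b = b and l = l, unfolded grad S2_eq_Union] w]
    show ?thesis using * by blast
  qed
  show ?thesis
    using PDMC FB PS by blast
qed

end
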